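(* Let $(x^v,\mu^v)$ be a solution to the relaxed master problem (RMP) and let $d^v\in\mathcal D$ be such that $x^v\in\mathcal X_{d^v}$. Assume $x^v\in\mathcal K_{d^v}$ and $\mu^v<Q_{d^v}(x^v)$, where $$Q_{d^v}(x^v)=\sum_{s\in\mathcal S_{d^v}}\pi_{sd^v}Q(x^v,\xi_{sd^v}).$$ For each $s\in\mathcal S_{d^v}$ let $\rho^v_s$ be an optimal solution to the dual of the linear program $Q(x^v,\xi_{sd^v})$. Then $(x,\mu)=(x^v,\mu^v)$ violates the inequality $$\mu\ge\sum_{s\in\mathcal S_{d^v}}\pi_{sd^v}(\rho^v_s)^\top(h_{sd^v}-T_{sd^v}x)-U(1-\mathbb 1_{d^v}(x)).$$
   Context: Setting: $\mathcal X\subseteq\mathbb R^{n_1}$, $c\in\mathbb R^{n_1}$, $\mathcal D$ is a finite set, $(\mathcal X_d)_{d\in\mathcal D}$ is a partition of $\mathcal X$, and $\mathbb 1_d:\mathcal X\to\{0,1\}$ is the characteristic function of $\mathcal X_d$. Discrete distributions: for each $d\in\mathcal D$ the random data has a discrete distribution $\mathsf P_d$ with a finite set of scenarios $\mathcal S_d$; scenario $s\in\mathcal S_d$ has realization $\xi_{sd}=(q_{sd},W_{sd},T_{sd},h_{sd})$, with $q_{sd}\in\mathbb R^{n_2}$, $W_{sd}\in\mathbb R^{m_2\times n_2}$, $T_{sd}\in\mathbb R^{m_2\times n_1}$, $h_{sd}\in\mathbb R^{m_2}$, and probability $\pi_{sd}>0$, $\sum_{s\in\mathcal S_d}\pi_{sd}=1$.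 Second stage: $Q(x,\xi)=\min_{y\ge0}\{q^\top y: Wy=h-Tx\}$ for $\xi=(q,W,T,h)$, with value $+\infty$ if infeasible and $-\infty$ if unbounded. The dual of $Q(x,\xi)$ is $\max\{\rho^\top(h-Tx):\rho^\top W\le q^\top\}$. $\mathcal K_{sd}=\{x\in\mathbb R^{n_1}:\exists y\ge 0,\ W_{sd}y=h_{sd}-T_{sd}x\}$ and $\mathcal K_d=\bigcap_{s\in\mathcal S_d}\mathcal K_{sd}$. Constant $U$: it is assumed that $\infty>U\ge\max_{d\in\mathcal D}U_d-\min_{d\in\mathcal D}L_d$, where $U_d\ge\max_{x\in\mathcal X_d}\sum_{s\in\mathcal S_d}\pi_{sd}Q(x,\xi_{sd})$ and $L_d\le\min_{x\in\mathcal X_d}\sum_{s\in\mathcal S_d}\pi_{sd}Q(x,\xi_{sd})$. (RMP): given finite sets $\underline{\mathcal F_d},\underline{\mathcal O_d}$ of real-valued functions on $\mathcal X$ ($d\in\mathcal D$), minimize $c^\top x+\mu$ over $x\in\mathcal X$, $\mu\in\mathbb R$ subject to, for every $d\in\mathcal D$: if $x\in\mathcal X_d$ then $f(x)\le0$ for all $f\in\underline{\mathcal F_d}$ and $o(x)\le\mu$ for all $o\in\underline{\mathcal O_d}$. A "solution" to (RMP) is a feasible point. *)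

theory Defs
  imports "HOL-Analysis.Analysis"
begin

text \<open>A realization \<open>\<xi> = (q, W, T, h)\<close> of the random data.\<close>

record ('n1, 'n2, 'm2) realization =
  q_of :: "real ^ 'n2"
  W_of :: "real ^ 'n2 ^ 'm2"
  T_of :: "real ^ 'n1 ^ 'm2"
  h_of :: "real ^ 'm2"

text \<open>The order on vectors is the componentwise one.\<close>

definition primal_feasible ::
    "real ^ 'n1 \<Rightarrow> ('n1, 'n2::finite, 'm2::finite) realization \<Rightarrow> (real ^ 'n2) set" where
  "primal_feasible x \<xi> = {y. y \<ge> 0 \<and> W_of \<xi> *v y = h_of \<xi> - T_of \<xi> *v x}"

text \<open>The infimum in the extended reals is \<open>\<infinity>\<close> if the linear program is infeasible, \<open>-\<infinity>\<close> if it is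
  unbounded, and otherwise the minimum, which a linear program then attains.\<close>

definition Q :: "real ^ 'n1 \<Rightarrow> ('n1, 'n2::finite, 'm2::finite) realization \<Rightarrow> ereal" where
  "Q x \<xi> = (INF y \<in> primal_feasible x \<xi>. ereal (q_of \<xi> \<bullet> y))"

text \<open>In sums of extended reals, \<open>\<infinity> + (-\<infinity>) = \<infinity>\<close>: a decision that is infeasible
  in some scenario has expected value \<open>\<infinity>\<close>.\<close>

definition expected_Q ::
    "('d \<Rightarrow> 's set) \<Rightarrow> ('s \<Rightarrow> 'd \<Rightarrow> real) \<Rightarrow> ('s \<Rightarrow> 'd \<Rightarrow> ('n1, 'n2::finite, 'm2::finite) realization) \<Rightarrow>
     'd \<Rightarrow> real ^ 'n1 \<Rightarrow> ereal" where
  "expected_Q S p \<xi> d x = (\<Sum>s\<in>S d. ereal (p s d) * Q x (\<xi> s d))"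

definition K_scen :: "('n1::finite, 'n2::finite, 'm2::finite) realization \<Rightarrow> (real ^ 'n1) set" where
  "K_scen \<xi> = {x. \<exists>y\<ge>0. W_of \<xi> *v y = h_of \<xi> - T_of \<xi> *v x}"

definition K :: "('d \<Rightarrow> 's set) \<Rightarrow> ('s \<Rightarrow> 'd \<Rightarrow> ('n1, 'n2::finite, 'm2::finite) realization) \<Rightarrow>
     'd \<Rightarrow> (real ^ 'n1) set" where
  "K S \<xi> d = (\<Inter>s\<in>S d. K_scen (\<xi> s d))"

definition dual_feasible :: "('n1::finite, 'n2::finite, 'm2::finite) realization \<Rightarrow> (real ^ 'm2) set" where
  "dual_feasible \<xi> = {\<rho>. \<rho> v* W_of \<xi> \<le> q_of \<xi>}"

definition dual_objective ::
    "real ^ 'n1 \<Rightarrow> ('n1, 'n2::finite, 'm2::finite) realization \<Rightarrow> real ^ 'm2 \<Rightarrow> real" where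
  "dual_objective x \<xi> \<rho> = \<rho> \<bullet> (h_of \<xi> - T_of \<xi> *v x)"

definition dual_optimal ::
    "real ^ 'n1 \<Rightarrow> ('n1, 'n2::finite, 'm2::finite) realization \<Rightarrow> real ^ 'm2 \<Rightarrow> bool" where
  "dual_optimal x \<xi> \<rho> \<longleftrightarrow> \<rho> \<in> dual_feasible \<xi> \<and>
     (\<forall>\<rho>' \<in> dual_feasible \<xi>. dual_objective x \<xi> \<rho>' \<le> dual_objective x \<xi> \<rho>)"

text \<open>Indexed partitions; blocks are allowed to be empty.\<close>

definition indexed_partition :: "'a set \<Rightarrow> 'd set \<Rightarrow> ('d \<Rightarrow> 'a set) \<Rightarrow> bool" where
  "indexed_partition X D Xd \<longleftrightarrow> disjoint_family_on Xd D \<and> (\<Union>d\<in>D. Xd d) = X"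

record 'a min_problem =
  objective :: "'a \<Rightarrow> real"
  feasible_set :: "'a set"

text \<open>A solution is a feasible point; optimality is not required.\<close>

definition is_solution :: "'a min_problem \<Rightarrow> 'a \<Rightarrow> bool" where
  "is_solution P z \<longleftrightarrow> z \<in> feasible_set P"

text \<open>The relaxed master problem, with feasibility cuts \<open>Fc d\<close> and optimality cuts \<open>Oc d\<close>. Real-valued
  functions on \<open>X\<close> are represented by total functions, which are only evaluated on \<open>X\<close>.\<close>

definition RMP ::
    "real ^ 'n1 \<Rightarrow> (real ^ 'n1) set \<Rightarrow> 'd set \<Rightarrow> ('d \<Rightarrow> (real ^ 'n1) set) \<Rightarrow>
     ('d \<Rightarrow> (real ^ 'n1 \<Rightarrow> real) set) \<Rightarrow> ('d \<Rightarrow> (real ^ 'n1 \<Rightarrow> real) set) \<Rightarrow>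
     ((real ^ 'n1) \<times> real) min_problem" where
  "RMP c X D Xd Fc Oc =
     \<lparr> objective = (\<lambda>(x, \<mu>). c \<bullet> x + \<mu>),
       feasible_set = {(x, \<mu>). x \<in> X \<and>
         (\<forall>d\<in>D. x \<in> Xd d \<longrightarrow> (\<forall>f\<in>Fc d. f x \<le> 0) \<and> (\<forall>g\<in>Oc d. g x \<le> \<mu>))} \<rparr>"

definition satisfies_cut ::
    "('d \<Rightarrow> (real ^ 'n1) set) \<Rightarrow> ('d \<Rightarrow> 's set) \<Rightarrow> ('s \<Rightarrow> 'd \<Rightarrow> real) \<Rightarrow>
     ('s \<Rightarrow> 'd \<Rightarrow> ('n1, 'n2::finite, 'm2::finite) realization) \<Rightarrow> real \<Rightarrow> 'd \<Rightarrow> ('s \<Rightarrow> real ^ 'm2) \<Rightarrow>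
     (real ^ 'n1) \<times> real \<Rightarrow> bool" where
  "satisfies_cut Xd S p \<xi> U d \<rho> = (\<lambda>(x, \<mu>).
     \<mu> \<ge> (\<Sum>s\<in>S d. p s d * (\<rho> s \<bullet> (h_of (\<xi> s d) - T_of (\<xi> s d) *v x)))
          - U * (1 - indicator (Xd d) x))"

end

theory Submission
  imports Defs
begin

text \<open>
  The indicator equals one at \<open>xv\<close>, so the big-U term of the cut vanishes there, and the right-hand
  side of the cut is the expectation of the dual optimal values. The claim is then that this
  expectation is at least \<open>expected_Q S p \<xi> dv xv\<close>, which exceeds \<open>\<mu>v\<close>. Scenario by scenario this is
  the nontrivial half of linear programming duality (\<open>strong_duality_le\<close>): the optimal value of a
  feasible primal program is at most that of its dual.

  That inequality follows from the Farkas lemma in conic form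
  (\<open>convex_cone_hull_separation\<close>). If no primal feasible point had cost at most \<open>t\<close>, then
  \<open>(b, t)\<close> would lie outside the finitely generated cone of all pairs (resource, budget) that can
  be met by some \<open>y \<ge> 0\<close>. The resource part of a separating functional, negated and divided by
  the budget coefficient, would be a dual feasible point with objective value greater than \<open>t\<close>.
  Primal feasibility keeps the budget coefficient away from zero.
\<close>

text \<open>A finitely generated cone is closed, so a point outside it can be strictly separated from it;
  since the cone is invariant under scaling, the separating hyperplane can be moved to the origin.\<close>

lemma convex_cone_hull_separation:
  fixes G :: "'a::euclidean_space set"
  assumes "finite G" and "z \<notin> convex_cone hull G"
  obtains a where "a \<bullet> z < 0" and "\<And>g. g \<in> G \<Longrightarrow> 0 \<le> a \<bullet> g"
proof -
  let ?H = "convex_cone hull G"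
  obtain a \<beta> where a: "a \<bullet> z < \<beta>" "\<And>x. x \<in> ?H \<Longrightarrow> \<beta> < a \<bullet> x"
    using separating_hyperplane_closed_point
      [OF convex_convex_cone_hull closed_convex_cone_hull[OF \<open>finite G\<close>] \<open>z \<notin> ?H\<close>]
    by blast
  have "\<beta> < 0"
    using a(2)[OF convex_cone_hull_contains_0] by simp
  have "0 \<le> a \<bullet> g" if "g \<in> G" for g
  proof (rule ccontr)
    assume "\<not> 0 \<le> a \<bullet> g"
    \<comment> \<open>The multiple of \<open>g\<close> lying exactly on the separating hyperplane is still in the cone.\<close>
    have "(\<beta> / (a \<bullet> g)) *\<^sub>R g \<in> ?H"
      using \<open>\<beta> < 0\<close> \<open>\<not> 0 \<le> a \<bullet> g\<close> that
      by (intro convex_cone_hull_mul hull_inc) (auto simp: divide_nonpos_neg)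
    from a(2)[OF this] show False
      using \<open>\<not> 0 \<le> a \<bullet> g\<close> by simp
  qed
  with a(1) \<open>\<beta> < 0\<close> show thesis
    by (intro that[of a]) auto
qed

text \<open>A budget too small for the primal program is refuted by a separating functional, which is in
  turn a dual point of value above \<open>t\<close>. Working with a bound \<open>t\<close> instead of a dual optimal point
  avoids any discussion of attainment or of an unbounded primal program.\<close>

lemma primal_budget_if_dual_bounded:
  fixes W :: "real ^ 'n::finite ^ 'm::finite" and q :: "real ^ 'n" and b :: "real ^ 'm"
  assumes feasible: "y\<^sub>0 \<ge> 0" "W *v y\<^sub>0 = b"
    and bounded: "\<And>\<rho>. \<rho> v* W \<le> q \<Longrightarrow> \<rho> \<bullet> b \<le> t"
  obtains y where "y \<ge> 0" and "W *v y = b" and "q \<bullet> y \<le> t"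
proof (rule ccontr)
  assume "\<not> thesis"
  define C where "C = {(W *v y, r) | y r. y \<ge> 0 \<and> q \<bullet> y \<le> r}"
  \<comment> \<open>The unit vectors generate the orthant \<open>y \<ge> 0\<close>; the extra generator stands for unspent budget.\<close>
  define G where "G = insert (0, 1) (range (\<lambda>i. (W *v axis i 1, q $ i)))"
  have C: "(W *v y, r) \<in> C" if "y \<ge> 0" and "q \<bullet> y \<le> r" for y r
    using that by (auto simp: C_def)
  have "convex_cone C"
    unfolding convex_cone_iff
  proof (intro conjI ballI allI impI)
    show "0 \<in> C"
      using C[of 0 0] by (simp add: zero_prod_def)
  next
    fix u v assume "u \<in> C" "v \<in> C"
    then obtain y r y' r' where uv: "u = (W *v y, r)" "v = (W *v y', r')"
      and "y \<ge> 0" "y' \<ge> 0" "q \<bullet> y \<le> r" "q \<bullet> y' \<le> r'"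
      unfolding C_def by blast
    then have "(W *v (y + y'), r + r') \<in> C"
      by (intro C) (auto simp: inner_add_right less_eq_vec_def)
    then show "u + v \<in> C"
      by (simp add: uv matrix_vector_right_distrib)
  next
    fix u and k :: real assume "u \<in> C" "0 \<le> k"
    then obtain y r where u: "u = (W *v y, r)" and "y \<ge> 0" "q \<bullet> y \<le> r"
      unfolding C_def by blast
    with \<open>0 \<le> k\<close> have "(W *v (k *\<^sub>R y), k * r) \<in> C"
      by (intro C) (auto simp: less_eq_vec_def mult_left_mono)
    then show "k *\<^sub>R u \<in> C"
      by (simp add: u matrix_vector_mult_scaleR)
  qed
  moreover have "G \<subseteq> C"
  proof -
    have "(0, 1) \<in> C"
      using C[of 0 1] by simp
    moreover have "(W *v axis i 1, q $ i) \<in> C" for i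
      by (rule C) (simp_all add: less_eq_vec_def axis_def inner_axis[unfolded axis_def])
    ultimately show ?thesis
      by (auto simp: G_def)
  qed
  ultimately have "convex_cone hull G \<subseteq> C"
    by (intro hull_minimal)
  moreover have "(b, t) \<notin> C"
    using \<open>\<not> thesis\<close> that by (auto simp: C_def)
  ultimately have "(b, t) \<notin> convex_cone hull G"
    by blast
  moreover have "finite G"
    by (simp add: G_def)
  ultimately obtain a where sep: "a \<bullet> (b, t) < 0" "\<And>g. g \<in> G \<Longrightarrow> 0 \<le> a \<bullet> g"
    using convex_cone_hull_separation by blast
  obtain \<rho> \<sigma> where a: "a = (\<rho>, \<sigma>)"
    by (cases a)
  have neg: "\<rho> \<bullet> b + \<sigma> * t < 0"
    using sep(1) by (simp add: a)
  have "0 \<le> \<sigma>"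
    using sep(2)[of "(0, 1)"] by (simp add: a G_def)
  have col: "0 \<le> (\<rho> v* W) $ i + \<sigma> * q $ i" for i
    using sep(2)[of "(W *v axis i 1, q $ i)"]
    by (simp add: a G_def flip: dot_lmul_matrix) (simp add: inner_axis)
  show False
  proof (cases "\<sigma> = 0")
    case True
    \<comment> \<open>A functional without budget component would certify that the primal program is infeasible.\<close>
    have "\<rho> \<bullet> b = (\<rho> v* W) \<bullet> y\<^sub>0"
      using feasible(2) by (simp add: dot_lmul_matrix)
    also have "\<dots> \<ge> 0"
      using col feasible(1) True by (auto simp: inner_vec_def less_eq_vec_def intro!: sum_nonneg)
    finally show False
      using neg True by simp
  next
    case False
    with \<open>0 \<le> \<sigma>\<close> have "0 < \<sigma>"
      by simp
    \<comment> \<open>The sign change turns nonnegativity on the generators into dual feasibility.\<close>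
    define \<rho>' where "\<rho>' = (- 1 / \<sigma>) *\<^sub>R \<rho>"
    have "(\<rho>' v* W) $ i \<le> q $ i" for i
    proof -
      have "(\<rho>' v* W) $ i = - ((\<rho> v* W) $ i) / \<sigma>"
        by (simp add: \<rho>'_def vector_matrix_mult_def sum_divide_distrib sum_negf)
      also have "\<dots> \<le> q $ i"
        using col[of i] \<open>0 < \<sigma>\<close> by (simp add: field_simps)
      finally show ?thesis .
    qed
    then have "\<rho>' \<bullet> b \<le> t"
      by (intro bounded) (simp add: less_eq_vec_def)
    moreover have "\<rho>' \<bullet> b > t"
      using neg \<open>0 < \<sigma>\<close> by (simp add: \<rho>'_def field_simps)
    ultimately show False
      by simp
  qed
qed

lemma strong_duality_le:
  assumes "x \<in> K_scen \<xi>" and "dual_optimal x \<xi> \<rho>"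
  shows "Q x \<xi> \<le> ereal (dual_objective x \<xi> \<rho>)"
proof -
  obtain y\<^sub>0 where y\<^sub>0: "y\<^sub>0 \<ge> 0" "W_of \<xi> *v y\<^sub>0 = h_of \<xi> - T_of \<xi> *v x"
    using assms(1) by (auto simp: K_scen_def)
  have "\<rho>' \<bullet> (h_of \<xi> - T_of \<xi> *v x) \<le> dual_objective x \<xi> \<rho>" if "\<rho>' v* W_of \<xi> \<le> q_of \<xi>" for \<rho>'
    using assms(2) that by (auto simp: dual_optimal_def dual_feasible_def dual_objective_def)
  from primal_budget_if_dual_bounded[OF y\<^sub>0 this] obtain y
    where "y \<in> primal_feasible x \<xi>" and "q_of \<xi> \<bullet> y \<le> dual_objective x \<xi> \<rho>"
    unfolding primal_feasible_def by blast
  then show ?thesis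
    unfolding Q_def by (intro INF_lower2[of y]) auto
qed

theorem theorem4:
  fixes X :: "(real ^ 'n1) set"
    and c :: "real ^ 'n1"
    and D :: "'d set"
    and Xd :: "'d \<Rightarrow> (real ^ 'n1) set"
    and S :: "'d \<Rightarrow> 's set"
    and p :: "'s \<Rightarrow> 'd \<Rightarrow> real"
    and \<xi> :: "'s \<Rightarrow> 'd \<Rightarrow> ('n1::finite, 'n2::finite, 'm2::finite) realization"
    and U :: real
    and Ud Ld :: "'d \<Rightarrow> real"
    and Fc Oc :: "'d \<Rightarrow> (real ^ 'n1 \<Rightarrow> real) set"
    and xv :: "real ^ 'n1"
    and \<mu>v :: real
    and dv :: 'd
    and \<rho>v :: "'s \<Rightarrow> real ^ 'm2"
  assumes "finite D"
    and "indexed_partition X D Xd"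
    and "\<And>d. d \<in> D \<Longrightarrow> finite (S d)"
    and "\<And>d s. d \<in> D \<Longrightarrow> s \<in> S d \<Longrightarrow> p s d > 0"
    and "\<And>d. d \<in> D \<Longrightarrow> (\<Sum>s\<in>S d. p s d) = 1"
    and "\<And>d. d \<in> D \<Longrightarrow> ereal (Ud d) \<ge> (SUP x\<in>Xd d. expected_Q S p \<xi> d x)"
    and "\<And>d. d \<in> D \<Longrightarrow> ereal (Ld d) \<le> (INF x\<in>Xd d. expected_Q S p \<xi> d x)"
    and "U \<ge> Max (Ud ` D) - Min (Ld ` D)"
    and "\<And>d. d \<in> D \<Longrightarrow> finite (Fc d)"
    and "\<And>d. d \<in> D \<Longrightarrow> finite (Oc d)"
    and "is_solution (RMP c X D Xd Fc Oc) (xv, \<mu>v)"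
    and "dv \<in> D"
    and "xv \<in> Xd dv"
    and "xv \<in> K S \<xi> dv"
    and "ereal \<mu>v < expected_Q S p \<xi> dv xv"
    and "\<And>s. s \<in> S dv \<Longrightarrow> dual_optimal xv (\<xi> s dv) (\<rho>v s)"
  shows "\<not> satisfies_cut Xd S p \<xi> U dv \<rho>v (xv, \<mu>v)"
proof -
  let ?cut = "\<Sum>s\<in>S dv. p s dv * (\<rho>v s \<bullet> (h_of (\<xi> s dv) - T_of (\<xi> s dv) *v xv))"
  have "expected_Q S p \<xi> dv xv \<le> (\<Sum>s\<in>S dv. ereal (p s dv) * ereal (dual_objective xv (\<xi> s dv) (\<rho>v s)))"
    unfolding expected_Q_def
  proof (rule sum_mono)
    fix s assume s: "s \<in> S dv"
    have "Q xv (\<xi> s dv) \<le> ereal (dual_objective xv (\<xi> s dv) (\<rho>v s))"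
      using assms(14) assms(16)[OF s] s by (intro strong_duality_le) (auto simp: K_def)
    moreover have "0 \<le> ereal (p s dv)"
      using assms(4)[OF \<open>dv \<in> D\<close> s] by simp
    ultimately show "ereal (p s dv) * Q xv (\<xi> s dv)
        \<le> ereal (p s dv) * ereal (dual_objective xv (\<xi> s dv) (\<rho>v s))"
      by (rule ereal_mult_left_mono)
  qed
  also have "\<dots> = ereal ?cut"
    by (simp add: dual_objective_def)
  finally have "expected_Q S p \<xi> dv xv \<le> ereal ?cut" .
  with \<open>ereal \<mu>v < expected_Q S p \<xi> dv xv\<close> have "ereal \<mu>v < ereal ?cut"
    by (rule order.strict_trans2)
  then have "\<mu>v < ?cut"
    by (simp only: less_ereal.simps)
  then show ?thesis
    using \<open>xv \<in> Xd dv\<close> by (simp add: satisfies_cut_def)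
qed

end
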